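(* For every integer $n \geq 2$, \[w_{2n+1,8}^{+}=w_{2n+1,8}^{-}=\frac{2^{6n-2n-7}(2^{2n+3}-8)}{3}\] and \[w_{2n,8}=28 \times 8^{n-2}+\frac{2^{4n-5}-2^{3n-3}+2^{6n-6}-2^{3n}}{3}.\]
   Context: For $a_1,\ldots,a_n\in\mathbb{Z}/8\mathbb{Z}$, $M_{n}(a_1,\ldots,a_n):=\begin{pmatrix} a_{n} & -1 \\ 1 & 0\end{pmatrix}\cdots\begin{pmatrix} a_{1} & -1 \\ 1 & 0\end{pmatrix}$. Let $w_{n,8}^{+}$ (resp. $w_{n,8}^{-}$) be the number of $(a_1,\ldots,a_n)\in(\mathbb{Z}/8\mathbb{Z})^n$ with $M_n(a_1,\ldots,a_n)=Id$ (resp. $=-Id$), and $w_{n,8}:=w_{n,8}^{+}+w_{n,8}^{-}$. *)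

theory Defs
  imports "HOL-Analysis.Analysis"
begin

text \<open>
  The ring of integers modulo 8 is the numeral type \<open>8\<close>, whose \<open>comm_ring_1\<close>
  operations are arithmetic modulo 8. The tuple $(a_1,\ldots,a_n)$ is the list
  \<open>[a\<^sub>1, \<dots>, a\<^sub>n]\<close>.
\<close>

definition elem_mat :: "'a::comm_ring_1 \<Rightarrow> 'a^2^2" where
  "elem_mat a = vector [vector [a, -1], vector [1, 0]]"

text \<open>The factor of the first entry is the rightmost one.\<close>

primrec cont_mat :: "'a::comm_ring_1 list \<Rightarrow> 'a^2^2" where
  "cont_mat [] = mat 1"
| "cont_mat (a # as) = cont_mat as ** elem_mat a"

definition w8_plus :: "nat \<Rightarrow> nat" where
  "w8_plus n = card {as :: 8 list. length as = n \<and> cont_mat as = mat 1}"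

definition w8_minus :: "nat \<Rightarrow> nat" where
  "w8_minus n = card {as :: 8 list. length as = n \<and> cont_mat as = - mat 1}"

definition w8 :: "nat \<Rightarrow> nat" where
  "w8 n = w8_plus n + w8_minus n"

end

theory Submission
  imports Defs
begin

text \<open>
  Since \<open>M\<^sub>n\<close> has determinant 1, it equals \<open>\<plusminus>1\<close> for exactly one choice of \<open>a\<^sub>1\<close> if the product of
  the other factors maps \<open>(1, 0)\<close> to \<open>(0, \<minusplus>1)\<close>, and for no choice otherwise. The number of
  products of length \<open>k\<close> with the latter property is \<open>(T\<^sup>k f) (1, 0)\<close>, where \<open>f\<close> is the indicator
  function of \<open>{(0, \<plusminus>1)}\<close> and \<open>T\<close> is the operator \<open>(T f) (x, y) = (\<Sum>a. f (a x - y, x))\<close>. Now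
  \<open>T f\<close> is the indicator function of \<open>x = \<plusminus>1\<close>, and modulo 8 this is a combination of three
  functions of \<open>x\<close> that are eigenfunctions of \<open>T\<^sup>2\<close> on unimodular pairs: a constant (eigenvalue 64),
  a function that only distinguishes units from nonunits (eigenvalue 16), and the quadratic
  character that separates \<open>\<plusminus>1\<close> from \<open>\<plusminus>3\<close> (eigenvalue 8).

  Replacing every \<open>a\<^sub>i\<close> by \<open>-a\<^sub>i\<close> conjugates \<open>M\<^sub>n\<close> by a diagonal matrix and multiplies it by
  \<open>(-1)\<^sup>n\<close>, so both signs are equally frequent for odd \<open>n\<close>.
\<close>

definition num_cont_mat :: "nat \<Rightarrow> 'a::comm_ring_1^2^2 \<Rightarrow> nat" where
  "num_cont_mat n A = card {as. length as = n \<and> cont_mat as = A}"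

lemma mat_minus_one: "mat (- 1) = - (mat 1 :: 'a::comm_ring_1^'n^'n)"
  by (simp add: vec_eq_iff mat_def)

lemma w8_plus_eq_num_cont_mat: "w8_plus n = num_cont_mat n (mat 1 :: 8^2^2)"
  and w8_minus_eq_num_cont_mat: "w8_minus n = num_cont_mat n (mat (- 1) :: 8^2^2)"
  by (simp_all add: w8_plus_def w8_minus_def num_cont_mat_def mat_minus_one)

subsection \<open>Reversing all signs\<close>

lemma cont_mat_map_uminus:
  "cont_mat (map uminus as) $ i $ j
     = (if i = j then 1 else - 1) * (- 1) ^ length as * cont_mat as $ i $ j"
proof (induction as arbitrary: i j)
  case Nil
  show ?case by (simp add: mat_def)
next
  case (Cons a as)
  show ?case
    using exhaust_2[of i] exhaust_2[of j]
    by (auto simp: Cons.IH elem_mat_def matrix_matrix_mult_def sum_2 algebra_simps)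
qed

lemma cont_mat_map_uminus_eq_mat_uminus_iff:
  fixes as :: "'a::comm_ring_1 list"
  assumes "odd (length as)"
  shows "cont_mat (map uminus as) = mat (- e) \<longleftrightarrow> cont_mat as = mat e"
  using assms by (auto simp: vec_eq_iff forall_2 cont_mat_map_uminus mat_def)

lemma num_cont_mat_uminus:
  fixes e :: "'a::comm_ring_1"
  assumes "odd n"
  shows "num_cont_mat n (mat (- e)) = num_cont_mat n (mat e)"
proof -
  have "bij_betw (map uminus) {as. length as = n \<and> cont_mat as = mat e}
      {as. length as = n \<and> cont_mat as = mat (- e)}"
    using assms cont_mat_map_uminus_eq_mat_uminus_iff[of _ e]
      cont_mat_map_uminus_eq_mat_uminus_iff[of _ "- e"]
    by (intro bij_betw_byWitness[where f' = "map uminus"]) (auto simp: comp_def)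
  from bij_betw_same_card[OF this] show ?thesis
    by (simp add: num_cont_mat_def)
qed

subsection \<open>Eliminating the first entry\<close>

lemma elem_mat_mult_vec: "elem_mat a *v v = vector [a * v $ 1 - v $ 2, v $ 1]"
  by (simp add: vec_eq_iff forall_2 elem_mat_def matrix_vector_mult_def sum_2)

lemma det_cont_mat: "det (cont_mat as) = 1"
  by (induction as) (simp_all add: det_mul, simp add: elem_mat_def det_2)

lemma elem_mat_inverse:
  fixes a :: "'a::comm_ring_1"
  defines "B \<equiv> vector [vector [0, 1], vector [- 1, a]]"
  shows "elem_mat a ** B = mat 1" and "B ** elem_mat a = mat 1"
  by (simp_all add: B_def elem_mat_def vec_eq_iff forall_2 matrix_matrix_mult_def sum_2 mat_def)

lemma self_inverse_mult_eq_iff: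
  fixes e :: "'a::comm_monoid_mult"
  assumes "e * e = 1"
  shows "e * a = b \<longleftrightarrow> a = e * b"
proof -
  have "e * (e * c) = c" for c using assms by (simp flip: mult.assoc)
  then show ?thesis by metis
qed

lemma mult_elem_mat_eq_mat_iff:
  fixes N :: "'a::comm_ring_1^2^2"
  assumes det: "det N = 1" and sq: "e * e = 1"
  shows "N ** elem_mat a = mat e \<longleftrightarrow>
    N *v vector [1, 0] = vector [0, - e] \<and> a = e * N $ 2 $ 2"
proof -
  define B :: "'a^2^2" where "B = vector [vector [0, 1], vector [- 1, a]]"
  have "N ** elem_mat a = mat e \<longleftrightarrow> N = mat e ** B"
  proof
    assume "N ** elem_mat a = mat e"
    then have "mat e ** B = N ** (elem_mat a ** B)" by (simp add: matrix_mul_assoc)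
    then show "N = mat e ** B" by (simp add: B_def elem_mat_inverse)
  next
    assume "N = mat e ** B"
    then have "N ** elem_mat a = mat e ** (B ** elem_mat a)" by (simp add: matrix_mul_assoc)
    then show "N ** elem_mat a = mat e" by (simp add: B_def elem_mat_inverse)
  qed
  also have "\<dots> \<longleftrightarrow> N $ 1 $ 1 = 0 \<and> N $ 1 $ 2 = e \<and> N $ 2 $ 1 = - e \<and> N $ 2 $ 2 = e * a"
    by (simp add: B_def vec_eq_iff forall_2 matrix_matrix_mult_def sum_2 mat_def conj_ac)
  also have "\<dots> \<longleftrightarrow> N $ 1 $ 1 = 0 \<and> N $ 2 $ 1 = - e \<and> a = e * N $ 2 $ 2"
  proof -
    have "N $ 1 $ 2 = e" if "N $ 1 $ 1 = 0" "N $ 2 $ 1 = - e"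
    proof -
      have "e * N $ 1 $ 2 = 1" using det that by (simp add: det_2 mult.commute)
      then show ?thesis by (simp add: self_inverse_mult_eq_iff[OF sq])
    qed
    then show ?thesis using self_inverse_mult_eq_iff[OF sq, of a "N $ 2 $ 2"] by auto
  qed
  finally show ?thesis
    by (auto simp: vec_eq_iff forall_2 matrix_vector_mult_def sum_2)
qed

lemma num_cont_mat_Suc:
  fixes e :: "'a::comm_ring_1"
  assumes "e * e = 1"
  shows "num_cont_mat (Suc k) (mat e)
    = card {as. length as = k \<and> cont_mat as *v vector [1, 0] = vector [0, - e]}"
proof -
  have "{as. length as = Suc k \<and> cont_mat as = mat e} = (\<lambda>as. e * cont_mat as $ 2 $ 2 # as) `
      {as. length as = k \<and> cont_mat as *v vector [1, 0] = vector [0, - e]}"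
    using mult_elem_mat_eq_mat_iff[OF det_cont_mat assms] by (auto simp: length_Suc_conv)
  then show ?thesis
    by (simp add: num_cont_mat_def card_image inj_on_def)
qed

subsection \<open>The transfer operator\<close>

definition transfer_op :: "('a::{comm_ring_1,finite}^2 \<Rightarrow> real) \<Rightarrow> 'a^2 \<Rightarrow> real" where
  "transfer_op f v = (\<Sum>a\<in>UNIV. f (elem_mat a *v v))"

lemma funpow_transfer_op:
  "(transfer_op ^^ k) f v = (\<Sum>as | length as = k. f (cont_mat as *v v))"
proof (induction k arbitrary: v)
  case 0
  show ?case by simp
next
  case (Suc k)
  have lists_Suc: "{as :: 'a list. length as = Suc k}
      = (\<lambda>(as, a). a # as) ` ({as. length as = k} \<times> UNIV)"
    using lists_length_Suc_eq[of UNIV k] by simp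
  have "(transfer_op ^^ Suc k) f v
      = (\<Sum>a\<in>UNIV. \<Sum>as | length as = k. f (cont_mat (a # as) *v v))"
    by (simp add: transfer_op_def Suc.IH matrix_vector_mul_assoc)
  also have "\<dots> = (\<Sum>as | length as = k. \<Sum>a\<in>UNIV. f (cont_mat (a # as) *v v))"
    by (rule sum.swap)
  also have "\<dots> = (\<Sum>(as, a)\<in>{as. length as = k} \<times> UNIV. f (cont_mat (a # as) *v v))"
    by (rule sum.cartesian_product)
  also have "\<dots> = (\<Sum>as | length as = Suc k. f (cont_mat as *v v))"
    unfolding lists_Suc by (subst sum.reindex) (auto simp: inj_on_def case_prod_unfold)
  finally show ?case .
qed

lemma funpow_transfer_op_add:
  "(transfer_op ^^ k) (\<lambda>w. f w + g w) v = (transfer_op ^^ k) f v + (transfer_op ^^ k) g v"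
  by (simp add: funpow_transfer_op sum.distrib)

lemma funpow_transfer_op_divide:
  "(transfer_op ^^ k) (\<lambda>w. f w / c) v = (transfer_op ^^ k) f v / c"
  by (simp add: funpow_transfer_op sum_divide_distrib)

lemma transfer_op_of_bool_eq:
  fixes e :: "'a::{comm_ring_1,finite}"
  assumes "e * e = 1"
  shows "transfer_op (\<lambda>w. of_bool (w = vector [0, e])) = (\<lambda>v. of_bool (v $ 1 = e))"
proof
  fix v :: "'a^2"
  have "elem_mat a *v v = vector [0, e] \<longleftrightarrow> v $ 1 = e \<and> a = e * v $ 2" for a
    using self_inverse_mult_eq_iff[OF assms, of a "v $ 2"]
    by (auto simp: elem_mat_mult_vec vec_eq_iff forall_2 mult.commute)
  then show "transfer_op (\<lambda>w. of_bool (w = vector [0, e])) v = of_bool (v $ 1 = e)"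
    by (simp add: transfer_op_def of_bool_conj)
qed

lemma num_cont_mat_eq_transfer_op:
  fixes e :: "'a::{comm_ring_1,finite}"
  assumes "e * e = 1"
  shows "real (num_cont_mat (Suc (Suc k)) (mat e))
    = (transfer_op ^^ k) (\<lambda>v. of_bool (v $ 1 = - e)) (vector [1, 0])"
proof -
  have finite_lists: "finite {as :: 'a list. length as = Suc k}"
    using finite_lists_length_eq[of "UNIV :: 'a set" "Suc k"] by simp
  have "real (num_cont_mat (Suc (Suc k)) (mat e))
      = (\<Sum>as | length as = Suc k. of_bool (cont_mat as *v vector [1, 0] = vector [0, - e]))"
    using assms finite_lists by (simp add: num_cont_mat_Suc Collect_conj_eq)
  also have "\<dots> = (transfer_op ^^ Suc k) (\<lambda>v. of_bool (v = vector [0, - e])) (vector [1, 0])"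
    by (rule funpow_transfer_op[symmetric])
  also have "\<dots> = (transfer_op ^^ k) (\<lambda>v. of_bool (v $ 1 = - e)) (vector [1, 0])"
    using assms by (simp add: funpow_swap1 transfer_op_of_bool_eq)
  finally show ?thesis .
qed

definition unimodular :: "'a::comm_ring_1^2 \<Rightarrow> bool" where
  "unimodular v \<longleftrightarrow> (\<exists>r s. r * v $ 1 + s * v $ 2 = 1)"

lemma unimodular_elem_mat:
  assumes "unimodular v"
  shows "unimodular (elem_mat a *v v)"
proof -
  obtain r s where "r * v $ 1 + s * v $ 2 = 1"
    using assms by (auto simp: unimodular_def)
  then have "- s * (a * v $ 1 - v $ 2) + (r + s * a) * v $ 1 = 1"
    by (simp add: algebra_simps)
  then show ?thesis
    unfolding unimodular_def elem_mat_mult_vec vector_2 by blast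
qed

definition transfer_sq_eigen :: "real \<Rightarrow> ('a::{comm_ring_1,finite} \<Rightarrow> real) \<Rightarrow> bool" where
  "transfer_sq_eigen c g \<longleftrightarrow>
    (\<forall>v. unimodular v \<longrightarrow> transfer_op (transfer_op (\<lambda>w. g (w $ 1))) v = c * g (v $ 1))"

lemma funpow_transfer_op_eigen:
  assumes "transfer_sq_eigen c g" and "unimodular v"
  shows "(transfer_op ^^ (2 * m)) (\<lambda>w. g (w $ 1)) v = c ^ m * g (v $ 1)"
  using assms(2)
proof (induction m arbitrary: v)
  case 0
  show ?case by simp
next
  case (Suc m)
  have "(transfer_op ^^ (2 * Suc m)) (\<lambda>w. g (w $ 1)) v
      = (\<Sum>a\<in>UNIV. \<Sum>b\<in>UNIV. (transfer_op ^^ (2 * m)) (\<lambda>w. g (w $ 1))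
          (elem_mat b *v (elem_mat a *v v)))"
    by (simp add: transfer_op_def)
  also have "\<dots> = c ^ m * transfer_op (transfer_op (\<lambda>w. g (w $ 1))) v"
    by (simp add: Suc unimodular_elem_mat transfer_op_def sum_distrib_left)
  also have "\<dots> = c ^ Suc m * g (v $ 1)"
    using assms(1) Suc.prems by (simp add: transfer_sq_eigen_def)
  finally show ?case .
qed

subsection \<open>Eigenfunctions over finite rings\<close>

lemma transfer_op_transfer_op:
  "transfer_op (transfer_op (\<lambda>w. g (w $ 1))) v
    = (\<Sum>a\<in>UNIV. \<Sum>b\<in>UNIV. g (b * (a * v $ 1 - v $ 2) - v $ 1))"
  by (simp add: transfer_op_def elem_mat_mult_vec)

lemma bij_affine_unit:
  fixes u :: "'a::comm_ring_1"
  assumes "u dvd 1"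
  shows "bij (\<lambda>b. b * u - x)"
proof -
  obtain w where "u * w = 1" using assms by (metis dvdE)
  then have "c * u * w = c" "c * w * u = c" for c
    by (simp_all add: mult.assoc mult.commute[of w u])
  then show ?thesis
    by (intro bij_betw_byWitness[where f' = "\<lambda>c. (c + x) * w"]) auto
qed

lemma sum_affine_unit:
  fixes u :: "'a::{comm_ring_1,finite}"
  assumes "u dvd 1"
  shows "(\<Sum>b\<in>UNIV. g (b * u - x)) = (\<Sum>b\<in>UNIV. g b)"
  using sum.reindex_bij_betw[OF bij_affine_unit[OF assms]] .

lemma transfer_sq_eigen_const:
  "transfer_sq_eigen ((real CARD('a))\<^sup>2) (\<lambda>_ :: 'a::{comm_ring_1,finite}. 1)"
  by (simp add: transfer_sq_eigen_def transfer_op_def power2_eq_square)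

lemma unimodular_nonzero:
  assumes "unimodular v" and "\<not> v $ 2 dvd 1"
  shows "v $ 1 \<noteq> 0"
  using assms by (auto simp: unimodular_def mult.commute[of _ "v $ 2"] intro: dvdI[OF sym])

definition local_ring :: "'a::comm_ring_1 itself \<Rightarrow> bool" where
  "local_ring TYPE('a) \<longleftrightarrow> (\<forall>x y :: 'a. x + y dvd 1 \<longrightarrow> x dvd 1 \<or> y dvd 1)"

lemma local_ringD:
  fixes x y :: "'a::comm_ring_1"
  assumes "local_ring TYPE('a)" and "x + y dvd 1"
  shows "x dvd 1 \<or> y dvd 1"
  using assms by (simp add: local_ring_def)

lemma unimodular_local_ring:
  fixes v :: "'a::comm_ring_1^2"
  assumes "local_ring TYPE('a)" and "unimodular v" and "\<not> v $ 2 dvd 1"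
  shows "v $ 1 dvd 1"
proof -
  obtain r s where "r * v $ 1 + s * v $ 2 = 1"
    using assms(2) by (auto simp: unimodular_def)
  then have "r * v $ 1 dvd 1 \<or> s * v $ 2 dvd 1"
    using local_ringD[OF assms(1)] by simp
  then show ?thesis using assms(3) dvd_mult_right by blast
qed

definition nonunits :: "'a::comm_monoid_mult set" where
  "nonunits = {z. \<not> z dvd 1}"

text \<open>
  Over a local ring, this function and the constant 1 are the only eigenfunctions of \<open>T\<^sup>2\<close> that are
  1 on units and constant on nonunits.
\<close>

definition unit_contrast :: "'a::{comm_ring_1,finite} \<Rightarrow> real" where
  "unit_contrast x =
    (if x dvd 1 then 1 else - (real CARD('a) / real (card (nonunits :: 'a set))))"

lemma sum_if_unit:
  fixes p q :: real
  shows "(\<Sum>x\<in>(UNIV :: 'a::{comm_ring_1,finite} set). if x dvd 1 then p else q)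
    = (real CARD('a) - card (nonunits :: 'a set)) * p + card (nonunits :: 'a set) * q"
proof -
  have "{z :: 'a. z dvd 1} = - nonunits" by (auto simp: nonunits_def)
  then have "real (card {z :: 'a. z dvd 1}) = real CARD('a) - card (nonunits :: 'a set)"
    by (simp add: Compl_eq_Diff_UNIV card_Diff_subset of_nat_diff card_mono)
  then show ?thesis by (simp add: sum.If_cases nonunits_def Compl_eq)
qed

lemma sum_unit_contrast:
  "(\<Sum>x\<in>UNIV. unit_contrast (x :: 'a::{comm_ring_1,finite}))
    = - real (card (nonunits :: 'a set))"
  by (auto simp: unit_contrast_def sum_if_unit nonunits_def intro: exI[of _ 0])

lemma unit_contrast_diff_nonunit:
  fixes x z :: "'a::{comm_ring_1,finite}"
  assumes "local_ring TYPE('a)" and "\<not> z dvd 1"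
  shows "unit_contrast (z - x) = unit_contrast x"
proof -
  have "z - x dvd 1 \<longleftrightarrow> x dvd 1"
    using local_ringD[OF assms(1), of z "x - z"] local_ringD[OF assms(1), of z "- x"]
      minus_dvd_iff[of "z - x" 1] assms(2)
    by auto
  then show ?thesis by (simp add: unit_contrast_def)
qed

lemma sum_affine_unit_contrast:
  fixes u :: "'a::{comm_ring_1,finite}"
  assumes "local_ring TYPE('a)"
  shows "(\<Sum>b\<in>UNIV. unit_contrast (b * u - x)) =
    (if u dvd 1 then - real (card (nonunits :: 'a set)) else CARD('a) * unit_contrast x)"
proof (cases "u dvd 1")
  case True
  then show ?thesis by (simp add: sum_affine_unit sum_unit_contrast)
next
  case False
  then have "\<not> b * u dvd 1" for b using dvd_mult_right by blast
  with False show ?thesis by (simp add: unit_contrast_diff_nonunit[OF assms])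
qed

lemma transfer_sq_eigen_unit_contrast:
  assumes local_ring: "local_ring TYPE('a::{comm_ring_1,finite})"
  shows "transfer_sq_eigen ((real (card (nonunits :: 'a set)))\<^sup>2) (unit_contrast :: 'a \<Rightarrow> real)"
  unfolding transfer_sq_eigen_def transfer_op_transfer_op
proof (intro allI impI)
  fix v :: "'a^2"
  assume v: "unimodular v"
  define x y where "x = v $ 1" and "y = v $ 2"
  let ?m = "real (card (nonunits :: 'a set))"
  let ?inner = "\<lambda>u. \<Sum>b\<in>UNIV. unit_contrast (b * u - x)"
  note inner = sum_affine_unit_contrast[OF local_ring]
  have "(\<Sum>a\<in>UNIV. ?inner (a * x - y)) = ?m\<^sup>2 * unit_contrast x"
  proof (cases "x dvd 1")
    case True
    then have "(\<Sum>a\<in>UNIV. ?inner (a * x - y)) = (\<Sum>u\<in>UNIV. ?inner u)"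
      by (rule sum_affine_unit)
    also have "\<dots> = (real CARD('a) - ?m) * (- ?m) + ?m * CARD('a)"
      unfolding inner using True by (simp add: sum_if_unit) (simp add: unit_contrast_def)
    also have "\<dots> = ?m\<^sup>2 * unit_contrast x"
      using True by (simp add: unit_contrast_def power2_eq_square algebra_simps)
    finally show ?thesis .
  next
    case False
    then have "a * x - y dvd 1" for a
      using unimodular_local_ring[OF local_ring unimodular_elem_mat[OF v, of a]]
      by (simp add: elem_mat_mult_vec x_def y_def)
    then have "(\<Sum>a\<in>UNIV. ?inner (a * x - y)) = - (CARD('a) * ?m)"
      by (simp add: inner)
    also have "\<dots> = ?m\<^sup>2 * unit_contrast x"
      using False by (auto simp: unit_contrast_def power2_eq_square)
    finally show ?thesis .
  qed
  then show "(\<Sum>a\<in>UNIV. \<Sum>b\<in>UNIV. unit_contrast (b * (a * v $ 1 - v $ 2) - v $ 1))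
      = ?m\<^sup>2 * unit_contrast (v $ 1)"
    by (simp only: x_def y_def)
qed

lemma sum_affine_antiperiodic:
  fixes g :: "'a::{comm_ring_1,finite} \<Rightarrow> real"
  assumes antiperiodic: "\<And>x. g (x + s) = - g x" and "u dvd s"
  shows "(\<Sum>b\<in>UNIV. g (b * u - x)) = 0"
proof -
  obtain c where s: "s = u * c" using \<open>u dvd s\<close> by (auto simp: dvd_def)
  have "(\<Sum>b\<in>UNIV. g (b * u - x)) = (\<Sum>b\<in>UNIV. g ((b + c) * u - x))"
    by (rule sum.reindex_bij_betw[symmetric]) (simp add: bij_plus_right)
  also have "\<dots> = (\<Sum>b\<in>UNIV. g ((b * u - x) + s))"
    by (simp add: s algebra_simps)
  also have "\<dots> = - (\<Sum>b\<in>UNIV. g (b * u - x))"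
    by (simp add: antiperiodic sum_negf)
  finally show ?thesis by simp
qed

lemma transfer_sq_eigen_antiperiodic:
  fixes g :: "'a::{comm_ring_1,finite} \<Rightarrow> real"
  assumes antiperiodic: "\<And>x. g (x + s) = - g x" and dvd_s: "\<And>u. u \<noteq> 0 \<Longrightarrow> u dvd s"
    and even_g: "\<And>x. g (- x) = g x" and nonunit: "\<And>x. \<not> x dvd 1 \<Longrightarrow> g x = 0"
  shows "transfer_sq_eigen (real CARD('a)) g"
  unfolding transfer_sq_eigen_def transfer_op_transfer_op
proof (intro allI impI)
  fix v :: "'a^2"
  assume v: "unimodular v"
  have inner: "(\<Sum>b\<in>UNIV. g (b * u - v $ 1)) = of_bool (u = 0) * (CARD('a) * g (v $ 1))" for u
    using sum_affine_antiperiodic[of g s u "v $ 1"] antiperiodic dvd_s even_g by auto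
  show "(\<Sum>a\<in>UNIV. \<Sum>b\<in>UNIV. g (b * (a * v $ 1 - v $ 2) - v $ 1)) = CARD('a) * g (v $ 1)"
  proof (cases "v $ 1 dvd 1")
    case True
    have "(\<Sum>a\<in>UNIV. \<Sum>b\<in>UNIV. g (b * (a * v $ 1 - v $ 2) - v $ 1))
        = (\<Sum>u\<in>(UNIV :: 'a set). of_bool (u = 0) * (CARD('a) * g (v $ 1)))"
      unfolding inner
      using sum_affine_unit[OF True, of "\<lambda>u. of_bool (u = 0) * (CARD('a) * g (v $ 1))"] .
    then show ?thesis by simp
  next
    case False
    then have "a * v $ 1 - v $ 2 \<noteq> 0" for a
      using unimodular_nonzero[OF unimodular_elem_mat[OF v, of a]]
      by (simp add: elem_mat_mult_vec)
    then show ?thesis using nonunit[OF False] by (simp add: inner)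
  qed
qed

subsection \<open>The ring of integers modulo 8\<close>

lemma exhaust_8: "x = 0 \<or> x = 1 \<or> x = 2 \<or> x = 3 \<or> x = 4 \<or> x = 5 \<or> x = 6 \<or> x = 7" for x :: 8
proof -
  have "card {0, 1, 2, 3, 4, 5, 6, 7 :: 8} = CARD(8)" by simp
  then have "{0, 1, 2, 3, 4, 5, 6, 7 :: 8} = UNIV" by (metis card_subset_eq finite subset_UNIV)
  then show ?thesis by blast
qed

lemma unit_8_iff: "x dvd 1 \<longleftrightarrow> x \<in> {1, 3, 5, 7}" for x :: 8
proof
  assume "x dvd 1"
  then obtain y where y: "1 = x * y" by (auto simp: dvd_def)
  have "x \<noteq> 0 \<and> x \<noteq> 2 \<and> x \<noteq> 4 \<and> x \<noteq> 6"
    using y exhaust_8[of y] by auto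
  then show "x \<in> {1, 3, 5, 7}" using exhaust_8[of x] by blast
next
  assume "x \<in> {1, 3, 5, 7}"
  then have "1 = x * x" by auto
  then show "x dvd 1" by (rule dvdI)
qed

lemma card_nonunits_8: "card (nonunits :: 8 set) = 4"
proof -
  have nonunits_8: "(nonunits :: 8 set) = {0, 2, 4, 6}"
    using exhaust_8 by (auto simp: nonunits_def unit_8_iff)
  show ?thesis unfolding nonunits_8 by simp
qed

lemma local_ring_8: "local_ring TYPE(8)"
  unfolding local_ring_def
proof (intro allI impI)
  fix x y :: 8
  assume "x + y dvd 1"
  then show "x dvd 1 \<or> y dvd 1"
    using exhaust_8[of x] exhaust_8[of y] by (auto simp: unit_8_iff)
qed

lemma dvd_4_8: "u dvd 4" if "u \<noteq> 0" for u :: 8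
proof -
  have "4 = u * 4 \<or> 4 = u * 2 \<or> 4 = u * 1 \<or> 4 = u * 6"
    using that exhaust_8[of u] by auto
  then show ?thesis by (auto intro: dvdI)
qed

definition kronecker_two :: "8 \<Rightarrow> real" where
  "kronecker_two x = (if x = 1 \<or> x = 7 then 1 else if x = 3 \<or> x = 5 then - 1 else 0)"

lemma kronecker_two_add_4: "kronecker_two (x + 4) = - kronecker_two x"
  using exhaust_8[of x] by (auto simp: kronecker_two_def)

lemma transfer_sq_eigen_kronecker_two: "transfer_sq_eigen 8 kronecker_two"
proof -
  have "kronecker_two (- x) = kronecker_two x" for x
    using exhaust_8[of x] by (auto simp: kronecker_two_def)
  moreover have "kronecker_two x = 0" if "\<not> x dvd 1" for x
    using that by (auto simp: kronecker_two_def unit_8_iff)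
  ultimately show ?thesis
    using transfer_sq_eigen_antiperiodic[of kronecker_two 4] kronecker_two_add_4 dvd_4_8 by simp
qed

lemma sum_kronecker_two: "(\<Sum>x\<in>UNIV. kronecker_two x) = 0"
  using sum_affine_antiperiodic[of kronecker_two 4 1 0] kronecker_two_add_4 by simp

lemma of_bool_pm_one_8:
  "of_bool (x = 1) + of_bool (x = - 1)
    = 1 / 3 + unit_contrast x / 6 + kronecker_two x / 2" for x :: 8
  using exhaust_8[of x] unfolding unit_contrast_def card_nonunits_8
  by (auto simp: unit_8_iff kronecker_two_def)

lemma funpow_transfer_op_pm_one_8:
  fixes v :: "8^2"
  assumes "unimodular v"
  shows "(transfer_op ^^ (2 * m)) (\<lambda>w. of_bool (w $ 1 = 1) + of_bool (w $ 1 = - 1)) v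
    = 64 ^ m / 3 + 16 ^ m / 6 * unit_contrast (v $ 1) + 8 ^ m / 2 * kronecker_two (v $ 1)"
proof -
  have "(transfer_op ^^ (2 * m)) (\<lambda>_. 1) v = 64 ^ m"
    using funpow_transfer_op_eigen[OF transfer_sq_eigen_const assms] by simp
  moreover have "(transfer_op ^^ (2 * m)) (\<lambda>w. unit_contrast (w $ 1)) v
      = 16 ^ m * unit_contrast (v $ 1)"
    using funpow_transfer_op_eigen[OF transfer_sq_eigen_unit_contrast[OF local_ring_8] assms]
    by (simp add: card_nonunits_8)
  moreover have "(transfer_op ^^ (2 * m)) (\<lambda>w. kronecker_two (w $ 1)) v
      = 8 ^ m * kronecker_two (v $ 1)"
    by (rule funpow_transfer_op_eigen[OF transfer_sq_eigen_kronecker_two assms])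
  ultimately show ?thesis
    by (simp add: of_bool_pm_one_8 funpow_transfer_op_add funpow_transfer_op_divide)
qed

lemma w8_eq_transfer_op:
  "real (w8 (Suc (Suc k)))
    = (transfer_op ^^ k) (\<lambda>w. of_bool (w $ 1 = 1) + of_bool (w $ 1 = - 1)) (vector [1, 0] :: 8^2)"
  using num_cont_mat_eq_transfer_op[of "1 :: 8" k] num_cont_mat_eq_transfer_op[of "- 1 :: 8" k]
  by (simp add: w8_def w8_plus_eq_num_cont_mat w8_minus_eq_num_cont_mat funpow_transfer_op_add)

lemma w8_even: "real (w8 (2 * m + 2)) = 64 ^ m / 3 + 16 ^ m / 6 + 8 ^ m / 2"
proof -
  have "unimodular (vector [1, 0] :: 8^2)" by (auto simp: unimodular_def)
  then show ?thesis
    by (simp add: w8_eq_transfer_op funpow_transfer_op_pm_one_8 unit_contrast_def kronecker_two_def)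
qed

lemma w8_odd: "real (w8 (2 * m + 3)) = (8 * 64 ^ m - 2 * 16 ^ m) / 3"
proof -
  have "unimodular (vector [a, 1] :: 8^2)" for a by (auto simp: unimodular_def intro: exI[of _ 0])
  then have "real (w8 (2 * m + 3)) = (\<Sum>a\<in>UNIV. 64 ^ m / 3 + 16 ^ m / 6 * unit_contrast (a :: 8)
      + 8 ^ m / 2 * kronecker_two a)"
    using w8_eq_transfer_op[of "Suc (2 * m)"]
    by (simp add: transfer_op_def elem_mat_mult_vec funpow_transfer_op_pm_one_8 numeral_3_eq_3)
  then show ?thesis
    by (simp add: sum.distrib sum_unit_contrast sum_kronecker_two card_nonunits_8
        flip: sum_distrib_left sum_divide_distrib)
qed

lemma w8_plus_eq_w8_minus:
  assumes "odd n"
  shows "w8_plus n = w8_minus n"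
  using num_cont_mat_uminus[OF assms, of "1 :: 8"]
  by (simp add: w8_plus_eq_num_cont_mat w8_minus_eq_num_cont_mat)

theorem theorem1p5:
  fixes n :: nat
  assumes "n \<ge> 2"
  shows "w8_plus (2 * n + 1) = w8_minus (2 * n + 1)
    \<and> real (w8_minus (2 * n + 1)) = 2 ^ (6 * n - 2 * n - 7) * (2 ^ (2 * n + 3) - 8) / 3
    \<and> real (w8 (2 * n)) = 28 * 8 ^ (n - 2)
        + (2 ^ (4 * n - 5) - 2 ^ (3 * n - 3) + 2 ^ (6 * n - 6) - 2 ^ (3 * n)) / 3"
proof (intro conjI)
  obtain j where n: "n = j + 2" using assms by (metis add.commute le_Suc_ex)
  have powers: "(2 :: real) ^ (2 * j) = 4 ^ j" "(2 :: real) ^ (3 * j) = 8 ^ j"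
    "(2 :: real) ^ (4 * j) = 16 ^ j" "(2 :: real) ^ (6 * j) = 64 ^ j"
    "(64 :: real) ^ j = 16 ^ j * 4 ^ j"
    by (simp_all add: power_mult flip: power_mult_distrib)
  show sym: "w8_plus (2 * n + 1) = w8_minus (2 * n + 1)"
    by (rule w8_plus_eq_w8_minus) simp
  have exps: "6 * n - 2 * n - 7 = 4 * j + 1" "2 * n + 3 = 2 * j + 7" "2 * n + 1 = 2 * (j + 1) + 3"
    by (simp_all add: n)
  from sym have "2 * real (w8_minus (2 * n + 1)) = real (w8 (2 * n + 1))"
    by (simp add: w8_def)
  then show "real (w8_minus (2 * n + 1)) = 2 ^ (6 * n - 2 * n - 7) * (2 ^ (2 * n + 3) - 8) / 3"
    unfolding exps w8_odd power_add powers by (simp add: field_simps)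
  have "4 * n - 5 = 4 * j + 3" "3 * n - 3 = 3 * j + 3" "6 * n - 6 = 6 * j + 6" "3 * n = 3 * j + 6"
    "n - 2 = j" "2 * n = 2 * (j + 1) + 2"
    by (simp_all add: n)
  then show "real (w8 (2 * n)) = 28 * 8 ^ (n - 2)
        + (2 ^ (4 * n - 5) - 2 ^ (3 * n - 3) + 2 ^ (6 * n - 6) - 2 ^ (3 * n)) / 3"
    by (simp only: w8_even power_add powers) (simp add: field_simps)
qed

end
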